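(* Let $K$ and $L$ be compact Hausdorff spaces such that there is a positive isomorphic embedding $C(K)\to C(L)$. Then $\tau(K)\le \tau(L)$. Moreover, if $L$ is Frechet then $K$ is Frechet; if $L$ is sequential then $K$ is sequential; and if $L$ is sequentially compact then $K$ is sequentially compact.
   Context: $C(K)$ is the Banach space of real-valued continuous functions on $K$ with the supremum norm. An isomorphic embedding $T:C(K)\to C(L)$ is a linear operator (not necessarily surjective) for which there are constants $m_1,m_2>0$ with $m_1\|g\|\le\|Tg\|\le m_2\|g\|$ for all $g\in C(K)$. $T$ is positive if $g\ge 0$ implies $Tg\ge 0$. The tightness $\tau(X)$ of a topological space $X$ is the least cardinal number such that for every $A\subseteq X$ and $x\in\overline{A}$ there is $I\subseteq A$ with $|I|\le\tau(X)$ and $x\in\overline{I}$. A space $X$ is Frechet if for every $A\subseteq X$ and $x\in\overline{A}$ there is a sequence in $A$ converging to $x$; sequential if for every nonclosed $A\subseteq X$ there is a sequence in $A$ converging to a point of $X\setminus A$; sequentially compact if every sequence in $X$ has a converging subsequence. *)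

theory Defs
  imports "HOL-Analysis.Analysis"
begin

unbundle cardinal_syntax

text \<open>
  A topological space is a type of class \<open>topological_space\<close>. If the type is compact, every
  continuous function on it is bounded, so \<open>'k \<Rightarrow>\<^sub>C real\<close> is \<open>C(K)\<close> with the supremum norm.
\<close>

definition isomorphic_embedding ::
    "('a::real_normed_vector \<Rightarrow> 'b::real_normed_vector) \<Rightarrow> bool" where
  "isomorphic_embedding T \<longleftrightarrow>
     linear T \<and>
     (\<exists>m1 m2. m1 > 0 \<and> m2 > 0 \<and> (\<forall>g. m1 * norm g \<le> norm (T g) \<and> norm (T g) \<le> m2 * norm g))"

definition positive_operator ::
    "(('k::topological_space \<Rightarrow>\<^sub>C real) \<Rightarrow> ('l::topological_space \<Rightarrow>\<^sub>C real)) \<Rightarrow> bool" where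
  "positive_operator T \<longleftrightarrow>
     (\<forall>g. (\<forall>x. 0 \<le> apply_bcontfun g x) \<longrightarrow> (\<forall>y. 0 \<le> apply_bcontfun (T g) y))"

definition tightness_bound :: "'a::topological_space itself \<Rightarrow> 'c rel \<Rightarrow> bool" where
  "tightness_bound _ r \<longleftrightarrow>
     (\<forall>(A :: 'a set) x. x \<in> closure A \<longrightarrow> (\<exists>I. I \<subseteq> A \<and> |I| \<le>o r \<and> x \<in> closure I))"

text \<open>
  Cardinals are well-orders of minimal order type, compared by \<open>\<le>o\<close>, and finite cardinals are
  allowed. The tightness is at most the cardinality of the space, so it can be represented by a
  relation on the space itself; it is determined up to \<open>=o\<close>. Lemma \<open>tightness_least\<close> shows
  that it is least among bounds represented on any type.
\<close>

definition tightness :: "'a::topological_space itself \<Rightarrow> 'a rel" where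
  "tightness X =
     (SOME r. Card_order r \<and> tightness_bound X r \<and>
        (\<forall>s :: 'a rel. Card_order s \<and> tightness_bound X s \<longrightarrow> r \<le>o s))"

lemma tightness_bound_mono:
  "tightness_bound X r \<Longrightarrow> r \<le>o s \<Longrightarrow> tightness_bound X s"
  unfolding tightness_bound_def by (meson ordLeq_transitive)

lemma tightness_bound_UNIV:
  "tightness_bound TYPE('a::topological_space) |UNIV :: 'a set|"
  unfolding tightness_bound_def by (meson card_of_mono1 subset_UNIV order_refl)

lemma
  fixes X :: "'a::topological_space itself"
  shows Card_order_tightness: "Card_order (tightness X)"
    and tightness_bound_tightness: "tightness_bound X (tightness X)"
    and tightness_least_same_type:
      "Card_order (s :: 'a rel) \<Longrightarrow> tightness_bound X s \<Longrightarrow> tightness X \<le>o s"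
proof -
  define R where "R = {r :: 'a rel. Card_order r \<and> tightness_bound X r}"
  have "|UNIV :: 'a set| \<in> R"
    using tightness_bound_UNIV[where 'a = 'a] card_of_Card_order[of "UNIV :: 'a set"]
    by (simp add: R_def tightness_bound_def del: Field_card_of)
  then obtain r where r: "r \<in> R" and min: "\<And>s. (s, r) \<in> ordLess \<Longrightarrow> s \<notin> R"
    using wfE_min[OF wf_ordLess] by metis
  have "r \<le>o s" if "s \<in> R" for s
    using that r min[of s] ordLess_or_ordLeq[of s r]
    unfolding R_def card_order_on_def by blast
  with r have "Card_order r \<and> tightness_bound X r \<and>
      (\<forall>s :: 'a rel. Card_order s \<and> tightness_bound X s \<longrightarrow> r \<le>o s)"
    by (simp add: R_def)
  from someI[of "\<lambda>r. Card_order r \<and> tightness_bound X r \<and>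
      (\<forall>s :: 'a rel. Card_order s \<and> tightness_bound X s \<longrightarrow> r \<le>o s)", OF this]
  have *: "Card_order (tightness X) \<and> tightness_bound X (tightness X) \<and>
      (\<forall>s :: 'a rel. Card_order s \<and> tightness_bound X s \<longrightarrow> tightness X \<le>o s)"
    unfolding tightness_def .
  from * show "Card_order (tightness X)" by blast
  from * show "tightness_bound X (tightness X)" by blast
  from * show "Card_order (s :: 'a rel) \<Longrightarrow> tightness_bound X s \<Longrightarrow> tightness X \<le>o s" by blast
qed

lemma tightness_least:
  fixes X :: "'a::topological_space itself" and s :: "'c rel"
  assumes s: "Card_order s" and bound: "tightness_bound X s"
  shows "tightness X \<le>o s"
proof -
  consider "|UNIV :: 'a set| \<le>o s" | "s \<le>o |UNIV :: 'a set|"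
    using ordLeq_total[of s "|UNIV :: 'a set|"] s card_of_Well_order[of "UNIV :: 'a set"]
    unfolding card_order_on_def by blast
  then show ?thesis
  proof cases
    case 1
    have "tightness X \<le>o |UNIV :: 'a set|"
      using tightness_least_same_type[of "|UNIV :: 'a set|" X] tightness_bound_UNIV[where 'a = 'a]
        card_of_Card_order[of "UNIV :: 'a set"]
      by (simp add: tightness_bound_def del: Field_card_of)
    then show ?thesis using 1 by (rule ordLeq_transitive)
  next
    case 2
    have sF: "|Field s| =o s" using s by (rule card_of_Field_ordIso)
    then have "|Field s| \<le>o |UNIV :: 'a set|" using 2 by (rule ordIso_ordLeq_trans)
    then obtain f :: "'c \<Rightarrow> 'a" where f: "inj_on f (Field s)"
      using card_of_ordLeq[of "Field s" "UNIV :: 'a set"] by auto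
    then have "|Field s| =o |f ` Field s|"
      by (meson card_of_ordIsoI inj_on_imp_bij_betw)
    then have eq: "s =o |f ` Field s|"
      using sF by (meson ordIso_symmetric ordIso_transitive)
    then have "tightness_bound X |f ` Field s|"
      using bound tightness_bound_mono ordIso_imp_ordLeq by blast
    then have "tightness X \<le>o |f ` Field s|"
      by (intro tightness_least_same_type card_of_Card_order)
    then show ?thesis using eq by (meson ordIso_symmetric ordLeq_ordIso_trans)
  qed
qed

definition frechet_space :: "'a::topological_space itself \<Rightarrow> bool" where
  "frechet_space _ \<longleftrightarrow>
     (\<forall>(A :: 'a set) x. x \<in> closure A \<longrightarrow> (\<exists>s :: nat \<Rightarrow> 'a. (\<forall>n. s n \<in> A) \<and> s \<longlonglongrightarrow> x))"

definition sequential_space :: "'a::topological_space itself \<Rightarrow> bool" where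
  "sequential_space _ \<longleftrightarrow>
     (\<forall>A :: 'a set. \<not> closed A \<longrightarrow>
        (\<exists>(s :: nat \<Rightarrow> 'a) x. (\<forall>n. s n \<in> A) \<and> x \<notin> A \<and> s \<longlonglongrightarrow> x))"

end

theory Submission
  imports Defs
begin

text \<open>
  Let \<open>m > 0\<close> satisfy \<open>m * norm g \<le> norm (T g)\<close> for all \<open>g\<close>. Each \<open>y \<in> L\<close> gives the positive functional
  \<open>g \<mapsto> T g y\<close> on \<open>C(K)\<close>, that is, a positive measure on \<open>K\<close>. Let \<open>R \<subseteq> L \<times> K\<close> consist of the
  pairs \<open>(y, x)\<close> for which this measure gives the point \<open>x\<close> mass at least \<open>m\<close>. Measures can be
  avoided: the condition says that \<open>m * g x \<le> T g y\<close> for all \<open>g \<ge> 0\<close>, and in this form it is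
  visibly closed, so \<open>R\<close> is compact.

  Every \<open>x \<in> K\<close> occurs in \<open>R\<close>. The functions \<open>h\<close> with \<open>0 \<le> h \<le> 1\<close> and \<open>h x = 1\<close> are directed
  downwards, and for each of them \<open>{y. m \<le> T h y}\<close> is closed and nonempty; by compactness these
  sets have a common point (\<open>ex_large_point_mass\<close>). On the other hand each \<open>y \<in> L\<close> is paired
  with only finitely many points, since distinct points have disjoint masses whose total is at
  most \<open>T 1 y\<close> (\<open>finite_large_point_masses\<close>).

  So \<open>K\<close> is a continuous image of the compact space \<open>R\<close>, and \<open>R\<close> maps to \<open>L\<close> with finite fibres.
  All four properties pass from \<open>L\<close> to \<open>R\<close> and from \<open>R\<close> to \<open>K\<close>. The second step is routine
  because the projection of \<open>R\<close> onto \<open>K\<close> is a closed map. In the first step a point of \<open>R\<close> is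
  separated from the rest of its finite fibre by a closed neighbourhood, and within this
  neighbourhood closures and limits can be tested after mapping to \<open>L\<close>
  (\<open>closed_if_closed_images\<close>, \<open>eventually_near_fibre\<close>).
\<close>

section \<open>Maps with finite fibres on a compact set\<close>

lemma closure_neighbourhood_avoiding_finite:
  fixes x :: "'a::t2_space"
  assumes "finite F" "x \<notin> F"
  obtains V where "open V" "x \<in> V" "closure V \<inter> F = {}"
proof -
  from assms have "\<exists>V. open V \<and> x \<in> V \<and> closure V \<inter> F = {}"
  proof (induction F)
    case empty
    show ?case by (intro exI[of _ UNIV]) auto
  next
    case (insert z F)
    then obtain V where V: "open V" "x \<in> V" "closure V \<inter> F = {}" by auto
    from insert.prems obtain U W where UW: "open U" "open W" "x \<in> U" "z \<in> W" "U \<inter> W = {}"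
      by (metis hausdorff insertI1)
    then have "W \<inter> closure U = {}"
      by (subst open_Int_closure_eq_empty) auto
    then have "closure (U \<inter> V) \<inter> insert z F = {}"
      using V UW closure_mono[of "U \<inter> V" U] closure_mono[of "U \<inter> V" V] by auto
    then show ?case using V UW by (intro exI[of _ "U \<inter> V"]) auto
  qed
  then show thesis using that by blast
qed

lemma isolate_in_fibre:
  fixes x :: "'a::t2_space"
  assumes "finite {z \<in> S. f z = f x}"
  obtains V where "open V" "x \<in> V" "\<And>z. z \<in> S \<inter> closure V \<Longrightarrow> f z = f x \<Longrightarrow> z = x"
proof -
  obtain V where "open V" "x \<in> V" "closure V \<inter> ({z \<in> S. f z = f x} - {x}) = {}"
    using closure_neighbourhood_avoiding_finite[of "{z \<in> S. f z = f x} - {x}" x] assms by blast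
  then show thesis using that[of V] by blast
qed

lemma in_closure_Int_neighbourhood:
  assumes "x \<in> closure A" "open V" "x \<in> V"
  shows "x \<in> closure (A \<inter> closure V)"
proof -
  have "x \<in> closure (V \<inter> A)"
    using open_Int_closure_subset[of V A] assms by blast
  moreover have "V \<inter> A \<subseteq> A \<inter> closure V"
    using closure_subset[of V] by blast
  ultimately show ?thesis using closure_mono by blast
qed

lemma closed_image_compact:
  fixes f :: "'x::t2_space \<Rightarrow> 'y::t2_space"
  assumes "compact S" "continuous_on S f" "closed C"
  shows "closed (f ` (S \<inter> C))"
  using assms
  by (meson Int_lower1 compact_Int_closed compact_continuous_image compact_imp_closed
      continuous_on_subset)

lemma image_closure_compact:
  fixes f :: "'x::t2_space \<Rightarrow> 'y::t2_space"
  assumes "compact S" "continuous_on S f" "A \<subseteq> S"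
  shows "f ` closure A = closure (f ` A)"
proof
  have sub: "closure A \<subseteq> S"
    using assms by (simp add: closure_minimal compact_imp_closed)
  then show "f ` closure A \<subseteq> closure (f ` A)"
    using assms by (intro continuous_image_closure_subset) auto
  have "closed (f ` (S \<inter> closure A))"
    using assms by (intro closed_image_compact) auto
  then have "closed (f ` closure A)" using sub by (simp add: inf_absorb2)
  then show "closure (f ` A) \<subseteq> f ` closure A"
    by (intro closure_minimal image_mono closure_subset)
qed

text \<open>
  A point \<open>x\<close> in the closure of \<open>F\<close> has a closed neighbourhood \<open>U\<close> that contains no other point
  of its fibre. As \<open>f ` (F \<inter> U)\<close> is closed, it contains \<open>f x\<close>, and the only point of \<open>U\<close> that can
  be responsible for this is \<open>x\<close> itself. This reduces a closedness problem upstairs to one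
  downstairs.
\<close>

lemma closed_if_closed_images:
  fixes f :: "'x::t2_space \<Rightarrow> 'y::t2_space"
  assumes S: "compact S" "continuous_on S f"
    and fin: "\<And>y. finite {z \<in> S. f z = y}"
    and F: "F \<subseteq> S"
    and img: "\<And>U. closed U \<Longrightarrow> closed (f ` (F \<inter> U))"
  shows "closed F"
proof -
  have "x \<in> F" if x: "x \<in> closure F" for x
  proof -
    obtain V where V: "open V" "x \<in> V" "\<And>z. z \<in> S \<inter> closure V \<Longrightarrow> f z = f x \<Longrightarrow> z = x"
      using isolate_in_fibre[OF fin] by blast
    have "x \<in> closure (F \<inter> closure V)"
      using in_closure_Int_neighbourhood[OF x V(1,2)] .
    then have "f x \<in> closure (f ` (F \<inter> closure V))"
      using image_closure_compact[OF S, of "F \<inter> closure V"] F by blast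
    then have "f x \<in> f ` (F \<inter> closure V)"
      using img[of "closure V"] by simp
    then obtain z where "z \<in> F" "z \<in> closure V" "f z = f x" by auto
    then show ?thesis using V(3)[of z] F by auto
  qed
  then show ?thesis
    by (metis closure_subset closure_eq subsetI subset_antisym)
qed

text \<open>
  The points of \<open>S\<close> outside \<open>V\<close> have a compact image that misses \<open>y\<close>, and the image sequence must
  leave it.
\<close>

lemma eventually_near_fibre:
  fixes f :: "'x::t2_space \<Rightarrow> 'y::t2_space"
  assumes S: "compact S" "continuous_on S f"
    and V: "open V" "{z \<in> S. f z = y} \<subseteq> V"
    and a: "\<And>n. a n \<in> S" "(\<lambda>n. f (a n)) \<longlonglongrightarrow> y"
  shows "\<forall>\<^sub>F n in sequentially. a n \<in> V"
proof -
  have "closed (f ` (S \<inter> - V))"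
    using S V(1) by (intro closed_image_compact) auto
  then have "open (- f ` (S \<inter> - V))" by auto
  moreover have "y \<in> - f ` (S \<inter> - V)" using V(2) by auto
  ultimately have "\<forall>\<^sub>F n in sequentially. f (a n) \<in> - f ` (S \<inter> - V)"
    using a(2) by (rule topological_tendstoD[rotated 1])
  then show ?thesis
    by (rule eventually_mono) (use a(1) in auto)
qed

lemma tendsto_if_isolated_in_fibre:
  fixes f :: "'x::t2_space \<Rightarrow> 'y::t2_space"
  assumes S: "compact S" "continuous_on S f"
    and U: "closed U" "\<And>z. z \<in> S \<inter> U \<Longrightarrow> f z = f x \<Longrightarrow> z = x"
    and a: "\<And>n. a n \<in> S \<inter> U" "(\<lambda>n. f (a n)) \<longlonglongrightarrow> f x"
  shows "a \<longlonglongrightarrow> x"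
proof (rule topological_tendstoI)
  fix V assume V: "open V" "x \<in> V"
  show "\<forall>\<^sub>F n in sequentially. a n \<in> V"
  proof (rule eventually_near_fibre[where S = "S \<inter> U" and f = f and y = "f x"])
    show "compact (S \<inter> U)" using S(1) U(1) by (rule compact_Int_closed)
    show "continuous_on (S \<inter> U) f" using S(2) by (rule continuous_on_subset) auto
    show "{z \<in> S \<inter> U. f z = f x} \<subseteq> V" using U(2) V(2) by auto
  qed (use V a in auto)
qed

section \<open>Tightness\<close>

text \<open>
  Finite cardinals, including zero, count as bounds. A point is in the closure of its own
  singleton but not in that of the empty set, which excludes zero.
\<close>

lemma singleton_ordLeq_tightness_bound:
  fixes x :: "'a::topological_space"
  assumes "tightness_bound TYPE('a) r"
  shows "|{b}| \<le>o r"
proof -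
  have "x \<in> closure {x}" using closure_subset by fast
  then obtain I where I: "I \<subseteq> {x}" "|I| \<le>o r" "x \<in> closure I"
    using assms unfolding tightness_bound_def by meson
  then have "I \<noteq> {}" by auto
  from card_of_singl_ordLeq[OF this] I(2) show ?thesis by (rule ordLeq_transitive)
qed

text \<open>
  A finite tightness forces every set to be closed, because finite sets are closed. A compact
  space of this kind is discrete, hence finite.
\<close>

lemma finite_if_finite_tightness_bound:
  assumes K: "compact (UNIV :: 'a::t2_space set)"
    and r: "tightness_bound TYPE('a) r" "Card_order r" "finite (Field r)"
  shows "finite (UNIV :: 'a set)"
proof (rule ccontr)
  assume "infinite (UNIV :: 'a set)"
  then obtain x :: 'a where "x islimpt UNIV"
    using Heine_Borel_imp_Bolzano_Weierstrass[OF K, of UNIV] by blast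
  then have "x islimpt (UNIV - {x})"
    by (simp add: islimpt_def) blast
  then have "x \<in> closure (UNIV - {x})"
    by (simp add: closure_def)
  then obtain I where I: "I \<subseteq> UNIV - {x}" "|I| \<le>o r" "x \<in> closure I"
    using r(1) unfolding tightness_bound_def by meson
  have "|I| \<le>o |Field r|"
    using I(2) card_of_Field_ordIso[OF r(2)] by (meson ordIso_symmetric ordLeq_ordIso_trans)
  then have "finite I" using r(3) by (rule card_of_ordLeq_finite)
  then have "x \<in> I" using I(3) by (simp add: finite_imp_closed)
  then show False using I(1) by blast
qed

text \<open>
  The idea for infinite \<open>r\<close> is to let \<open>F\<close> be the union of the closures of all subsets of \<open>A\<close> of
  size at most \<open>r\<close>. Since \<open>r\<close> many sets of size \<open>r\<close> have a union of size \<open>r\<close>, the set \<open>F\<close>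
  contains the closure of each of its own subsets of size at most \<open>r\<close>. The images of \<open>F \<inter> U\<close>
  inherit this, so they are closed, and then \<open>F\<close> is closed.
\<close>

lemma tightness_finite_fibres:
  fixes f :: "'x::t2_space \<Rightarrow> 'y::t2_space"
  assumes L: "compact (UNIV :: 'y set)"
    and S: "compact S" "continuous_on S f"
    and fin: "\<And>y. finite {z \<in> S. f z = y}"
    and r: "Card_order r" "tightness_bound TYPE('y) r"
    and A: "A \<subseteq> S" "x \<in> closure A"
  obtains I where "I \<subseteq> A" "|I| \<le>o r" "x \<in> closure I"
proof (cases "finite (Field r)")
  case True
  have "finite (\<Union>y. {z \<in> S. f z = y})"
    using fin finite_if_finite_tightness_bound[OF L r(2,1) True] by (intro finite_UN_I) auto
  then have "finite A" by (rule rev_finite_subset) (use A(1) in auto)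
  then have "x \<in> A" using A(2) by (simp add: finite_imp_closed)
  moreover have "x \<in> closure {x}" by simp
  ultimately show thesis
    by (intro that[of "{x}"] singleton_ordLeq_tightness_bound[OF r(2)]) auto
next
  case inf: False
  define F where "F = {z. \<exists>I\<subseteq>A. |I| \<le>o r \<and> z \<in> closure I}"
  have FS: "F \<subseteq> S"
  proof
    fix z assume "z \<in> F"
    then obtain I where "I \<subseteq> A" "z \<in> closure I" unfolding F_def by blast
    then show "z \<in> S" using closure_minimal[of I S] A(1) compact_imp_closed[OF S(1)] by blast
  qed
  have F_closed: "closure J \<subseteq> F" if J: "J \<subseteq> F" "|J| \<le>o r" for J
  proof -
    have "\<forall>j\<in>J. \<exists>I\<subseteq>A. |I| \<le>o r \<and> j \<in> closure I" using J(1) unfolding F_def by blast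
    then obtain I where I: "\<And>j. j \<in> J \<Longrightarrow> I j \<subseteq> A \<and> |I j| \<le>o r \<and> j \<in> closure (I j)"
      by metis
    define I' where "I' = (\<Union>j\<in>J. I j)"
    have "|I'| \<le>o r"
      unfolding I'_def using I J(2) inf r(1) by (intro card_of_UNION_ordLeq_infinite_Field) auto
    moreover have "I' \<subseteq> A" unfolding I'_def using I by blast
    moreover have "closure J \<subseteq> closure I'"
    proof (rule closure_minimal)
      show "J \<subseteq> closure I'"
      proof
        fix j assume j: "j \<in> J"
        then have "I j \<subseteq> I'" unfolding I'_def by blast
        then show "j \<in> closure I'" using I[OF j] closure_mono by blast
      qed
    qed simp
    ultimately show ?thesis unfolding F_def by blast
  qed
  have "closed F"
  proof (rule closed_if_closed_images[OF S fin FS])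
    fix U :: "'x set" assume U: "closed U"
    have "y \<in> f ` (F \<inter> U)" if y: "y \<in> closure (f ` (F \<inter> U))" for y
    proof -
      obtain J where J: "J \<subseteq> f ` (F \<inter> U)" "|J| \<le>o r" "y \<in> closure J"
        using y r(2) unfolding tightness_bound_def by meson
      \<comment> \<open>Representatives of the points of \<open>J\<close>, one for each point, so as not to enlarge \<open>J\<close>.\<close>
      obtain J' where J': "J' \<subseteq> F \<inter> U" "inj_on f J'" "J = f ` J'"
        using J(1) unfolding subset_image_inj by blast
      then have "|J'| \<le>o |J|"
        using card_of_ordLeq[of J' J] by blast
      then have "|J'| \<le>o r" using J(2) by (rule ordLeq_transitive)
      then have "closure J' \<subseteq> F \<inter> U"
        using F_closed[of J'] J'(1) closure_minimal[of J' U] U by auto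
      moreover have "y \<in> f ` closure J'"
        using image_closure_compact[OF S, of J'] J' FS J(3) by auto
      ultimately show ?thesis by blast
    qed
    then show "closed (f ` (F \<inter> U))"
      by (metis closure_subset closure_eq subsetI subset_antisym)
  qed
  moreover have "A \<subseteq> F"
  proof
    fix a assume "a \<in> A"
    moreover have "a \<in> closure {a}" by simp
    ultimately show "a \<in> F"
      unfolding F_def using singleton_ordLeq_tightness_bound[OF r(2)]
      by (intro CollectI exI[of _ "{a}"]) auto
  qed
  ultimately have "x \<in> F" using A(2) closure_minimal by blast
  then show thesis using that unfolding F_def by blast
qed

section \<open>Sequences\<close>

text \<open>
  If the range of the sequence is infinite, it accumulates at some \<open>z\<close>, and removing \<open>z\<close> leaves a
  set that is not closed. Sequentiality yields a sequence in this set with a limit outside it.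
  Such a sequence visits each index of the original one only finitely often, so it can be thinned
  out to a subsequence.
\<close>

lemma sequential_imp_seq_compact:
  assumes K: "compact (UNIV :: 'a::t2_space set)" and seq: "sequential_space TYPE('a)"
  shows "seq_compact (UNIV :: 'a set)"
  unfolding seq_compact_def
proof (intro allI impI)
  fix a :: "nat \<Rightarrow> 'a"
  show "\<exists>l\<in>UNIV. \<exists>r. strict_mono r \<and> (a \<circ> r) \<longlonglongrightarrow> l"
  proof (cases "finite (range a)")
    case True
    then obtain c where "infinite (a -` {c})"
      using inf_img_fin_dom[of a UNIV] by auto
    then obtain r :: "nat \<Rightarrow> nat" where "strict_mono r" "\<And>n. r n \<in> a -` {c}"
      using infinite_enumerate by blast
    then show ?thesis
      by (intro bexI[of _ c] exI[of _ r]) (auto simp: o_def)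
  next
    case False
    then obtain z where "z islimpt range a"
      using Heine_Borel_imp_Bolzano_Weierstrass[OF K, of "range a"] by blast
    then have "z islimpt (range a - {z})"
      by (simp add: islimpt_def) blast
    then have "\<not> closed (range a - {z})"
      by (auto simp: closed_limpt)
    then obtain s w where s: "\<And>n. s n \<in> range a - {z}" "w \<notin> range a - {z}" "s \<longlonglongrightarrow> w"
      using seq unfolding sequential_space_def by meson
    then have "\<forall>k. \<exists>n. s k = a n" by blast
    then obtain n where n: "\<And>k. s k = a (n k)" by metis
    have "finite {k. n k = i}" for i
    proof (cases "a i = w")
      case True
      then have "{k. n k = i} = {}" using s(1,2) n by auto
      then show ?thesis by simp
    next
      case False
      have "\<forall>\<^sub>F k in sequentially. s k \<noteq> a i"
        using s(3) False by (intro tendsto_imp_eventually_ne) auto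
      then have "finite {k. s k = a i}"
        by (simp add: eventually_cofinite flip: cofinite_eq_sequentially)
      then show ?thesis by (rule rev_finite_subset) (use n in auto)
    qed
    then have "finite (\<Union>i\<in>{..N}. {k. n k = i})" for N by blast
    moreover have "(\<Union>i\<in>{..N}. {k. n k = i}) = {k. \<not> N < n k}" for N by auto
    ultimately have ev: "\<forall>\<^sub>F k in sequentially. N < n k" for N
      by (simp add: eventually_cofinite flip: cofinite_eq_sequentially)
    have "\<exists>k'. n k < n k' \<and> k < k'" for k
      using eventually_happens'[OF _ eventually_conj[OF ev[of "n k"] eventually_gt_at_top[of k]]]
      by simp
    then obtain nxt where nxt: "\<And>k. k < nxt k" "\<And>k. n k < n (nxt k)" by metis
    \<comment> \<open>Iterating \<open>nxt\<close> thins out \<open>s\<close> so that the indices into \<open>a\<close> increase as well.\<close>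
    define q where "q = rec_nat 0 (\<lambda>_. nxt)"
    have q: "q (Suc j) = nxt (q j)" for j by (simp add: q_def)
    have q_mono: "strict_mono q" and nq: "strict_mono (n \<circ> q)"
      by (auto simp: strict_mono_Suc_iff q nxt)
    have "(s \<circ> q) \<longlonglongrightarrow> w" using s(3) q_mono by (rule LIMSEQ_subseq_LIMSEQ)
    then have "(a \<circ> (n \<circ> q)) \<longlonglongrightarrow> w" by (simp add: o_def n)
    then show ?thesis using nq by blast
  qed
qed

text \<open>
  If the images converge to \<open>y\<close>, the sequence eventually stays in any neighbourhood of the fibre
  of \<open>y\<close>. With finitely many points in the fibre, one of them attracts infinitely many terms.
\<close>

lemma seq_compact_finite_fibres:
  fixes f :: "'x::t2_space \<Rightarrow> 'y::t2_space"
  assumes L: "seq_compact (UNIV :: 'y set)"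
    and S: "compact S" "continuous_on S f"
    and fin: "\<And>y. finite {z \<in> S. f z = y}"
  shows "seq_compact S"
  unfolding seq_compact_def
proof (intro allI impI)
  fix a0 :: "nat \<Rightarrow> 'x" assume a0: "\<forall>n. a0 n \<in> S"
  obtain y r where r: "strict_mono r" "((f \<circ> a0) \<circ> r) \<longlonglongrightarrow> y"
    using seq_compactE[OF L, of "f \<circ> a0"] by blast
  define a where "a = a0 \<circ> r"
  have a: "a n \<in> S" "(\<lambda>n. f (a n)) \<longlonglongrightarrow> y" for n
    using a0 r(2) by (auto simp: a_def o_def)
  let ?Y = "{z \<in> S. f z = y}"
  have "\<exists>V. open V \<and> x \<in> V \<and> (\<forall>z \<in> S \<inter> closure V. f z = f x \<longrightarrow> z = x)" for x
    using isolate_in_fibre[OF fin, of x] by metis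
  then obtain V where V: "\<And>x. open (V x)" "\<And>x. x \<in> V x"
      "\<And>x z. z \<in> S \<inter> closure (V x) \<Longrightarrow> f z = f x \<Longrightarrow> z = x"
    by metis
  have "\<forall>\<^sub>F n in sequentially. a n \<in> (\<Union>x\<in>?Y. V x)"
    using V(1,2) a by (intro eventually_near_fibre[OF S]) auto
  then have "finite {n. a n \<notin> (\<Union>x\<in>?Y. V x)}"
    by (simp add: eventually_cofinite flip: cofinite_eq_sequentially)
  then have "infinite (- {n. a n \<notin> (\<Union>x\<in>?Y. V x)})" by simp
  moreover have "- {n. a n \<notin> (\<Union>x\<in>?Y. V x)} = (\<Union>x\<in>?Y. {n. a n \<in> V x})" by auto
  ultimately obtain x where x: "x \<in> ?Y" "infinite {n. a n \<in> V x}"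
    using fin[of y] by auto
  then obtain q :: "nat \<Rightarrow> nat" where q: "strict_mono q" "\<And>n. a (q n) \<in> V x"
    using infinite_enumerate[of "{n. a n \<in> V x}"] by blast
  have "(a \<circ> q) \<longlonglongrightarrow> x"
  proof (rule tendsto_if_isolated_in_fibre[OF S, of "closure (V x)"])
    show "(a \<circ> q) n \<in> S \<inter> closure (V x)" for n
      using a(1) q(2) closure_subset[of "V x"] by auto
    show "(\<lambda>n. f ((a \<circ> q) n)) \<longlonglongrightarrow> f x"
      using LIMSEQ_subseq_LIMSEQ[OF a(2) q(1)] x(1) by (simp add: o_def)
  qed (use V(3) in auto)
  then show "\<exists>l\<in>S. \<exists>r. strict_mono r \<and> (a0 \<circ> r) \<longlonglongrightarrow> l"
    using x(1) strict_mono_o[OF r(1) q(1)]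
    by (intro bexI[of _ x] exI[of _ "r \<circ> q"]) (auto simp: a_def o_assoc)
qed

lemma sequential_finite_fibres:
  fixes f :: "'x::t2_space \<Rightarrow> 'y::t2_space"
  assumes L: "compact (UNIV :: 'y set)" "sequential_space TYPE('y)"
    and S: "compact S" "continuous_on S f"
    and fin: "\<And>y. finite {z \<in> S. f z = y}"
    and F: "F \<subseteq> S" "\<And>s x. (\<And>n. s n \<in> F) \<Longrightarrow> s \<longlonglongrightarrow> x \<Longrightarrow> x \<in> F"
  shows "closed F"
proof (rule closed_if_closed_images[OF S fin F(1)])
  have comp: "seq_compact S"
    using sequential_imp_seq_compact[OF L] S fin by (rule seq_compact_finite_fibres)
  fix U :: "'x set" assume U: "closed U"
  show "closed (f ` (F \<inter> U))"
  proof (rule ccontr)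
    assume "\<not> closed (f ` (F \<inter> U))"
    then obtain s y where s: "\<And>n. s n \<in> f ` (F \<inter> U)" "y \<notin> f ` (F \<inter> U)" "s \<longlonglongrightarrow> y"
      using L(2) unfolding sequential_space_def by meson
    then have "\<forall>n. \<exists>t. t \<in> F \<inter> U \<and> s n = f t" by blast
    then obtain t where t: "\<And>n. t n \<in> F \<inter> U" "\<And>n. s n = f (t n)" by metis
    then obtain x q where x: "x \<in> S" "strict_mono q" "(t \<circ> q) \<longlonglongrightarrow> x"
      using seq_compactE[OF comp, of t] F(1) by blast
    have "x \<in> F" using F(2)[OF _ x(3)] t(1) by simp
    moreover have "x \<in> U"
      using closed_sequentially[OF U _ x(3)] t(1) by auto
    moreover have "f x = y"
    proof (rule LIMSEQ_unique)
      show "(\<lambda>n. f ((t \<circ> q) n)) \<longlonglongrightarrow> f x"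
        using S(2) x(3,1) by (rule continuous_on_tendsto_compose) (use t(1) F(1) in \<open>auto intro!: always_eventually\<close>)
      show "(\<lambda>n. f ((t \<circ> q) n)) \<longlonglongrightarrow> y"
        using LIMSEQ_subseq_LIMSEQ[OF s(3) x(2)] by (simp add: o_def t(2))
    qed
    ultimately show False using s(2) by blast
  qed
qed

lemma frechet_finite_fibres:
  fixes f :: "'x::t2_space \<Rightarrow> 'y::t2_space"
  assumes L: "frechet_space TYPE('y)"
    and S: "compact S" "continuous_on S f"
    and fin: "\<And>y. finite {z \<in> S. f z = y}"
    and A: "A \<subseteq> S" "x \<in> closure A"
  obtains s where "\<And>n. s n \<in> A" "s \<longlonglongrightarrow> x"
proof -
  obtain V where V: "open V" "x \<in> V" "\<And>z. z \<in> S \<inter> closure V \<Longrightarrow> f z = f x \<Longrightarrow> z = x"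
    using isolate_in_fibre[OF fin] by blast
  have "x \<in> closure (A \<inter> closure V)"
    using in_closure_Int_neighbourhood[OF A(2) V(1,2)] .
  then have "f x \<in> closure (f ` (A \<inter> closure V))"
    using image_closure_compact[OF S, of "A \<inter> closure V"] A(1) by blast
  then obtain t where t: "\<And>n. t n \<in> f ` (A \<inter> closure V)" "t \<longlonglongrightarrow> f x"
    using L unfolding frechet_space_def by meson
  then have "\<forall>n. \<exists>a. a \<in> A \<inter> closure V \<and> t n = f a" by blast
  then obtain s where s: "\<And>n. s n \<in> A \<inter> closure V" "\<And>n. t n = f (s n)" by metis
  have "s \<longlonglongrightarrow> x"
  proof (rule tendsto_if_isolated_in_fibre[OF S, of "closure V"])
    show "s n \<in> S \<inter> closure V" for n using s(1) A(1) by blast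
    have "t = (\<lambda>n. f (s n))" using s(2) by blast
    then show "(\<lambda>n. f (s n)) \<longlonglongrightarrow> f x" using t(2) by simp
  qed (use V(3) in auto)
  then show thesis using that s(1) by blast
qed

section \<open>Images of compact sets with finite fibres\<close>

text \<open>
  Both maps start from the same compact set \<open>S\<close>. The first has finite fibres and carries the
  properties of its target over to \<open>S\<close>; the second is a closed surjection and carries them from
  \<open>S\<close> to its own target.
\<close>

locale finite_fibre_correspondence =
  fixes S :: "'x::t2_space set" and f :: "'x \<Rightarrow> 'y::t2_space" and g :: "'x \<Rightarrow> 'z::t2_space"
  assumes compact_target: "compact (UNIV :: 'y set)"
    and S: "compact S"
    and f: "continuous_on S f"
    and g: "continuous_on S g"
    and fin: "\<And>y. finite {z \<in> S. f z = y}"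
    and surj: "g ` S = UNIV"
begin

lemma image_preimage: "g ` (S \<inter> g -` A) = A"
proof -
  have "g ` (S \<inter> g -` A) = g ` S \<inter> A" by blast
  then show ?thesis using surj by simp
qed

lemma closure_lift:
  assumes "x \<in> closure A"
  obtains z where "z \<in> closure (S \<inter> g -` A)" "g z = x" "z \<in> S"
proof -
  have "x \<in> g ` closure (S \<inter> g -` A)"
    using image_closure_compact[OF S g, of "S \<inter> g -` A"] assms by (simp add: image_preimage)
  then obtain z where "z \<in> closure (S \<inter> g -` A)" "g z = x" by auto
  moreover from this have "z \<in> S"
    using closure_minimal[of "S \<inter> g -` A" S] compact_imp_closed[OF S] by blast
  ultimately show thesis using that by blast
qed

lemma tendsto_image:
  assumes "s \<longlonglongrightarrow> z" "z \<in> S" "\<And>n. s n \<in> S"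
  shows "(\<lambda>n. g (s n)) \<longlonglongrightarrow> g z"
  using g assms(1,2) by (rule continuous_on_tendsto_compose) (use assms(3) in auto)

lemma tightness_bound_transfer:
  assumes r: "Card_order r" "tightness_bound TYPE('y) r"
  shows "tightness_bound TYPE('z) r"
  unfolding tightness_bound_def
proof (intro allI impI)
  fix A :: "'z set" and x assume "x \<in> closure A"
  then obtain z where z: "z \<in> closure (S \<inter> g -` A)" "g z = x" by (rule closure_lift)
  obtain I where I: "I \<subseteq> S \<inter> g -` A" "|I| \<le>o r" "z \<in> closure I"
    using tightness_finite_fibres[OF compact_target S f fin r _ z(1)] by blast
  have "x \<in> closure (g ` I)"
    using image_closure_compact[OF S g, of I] I z(2) by blast
  moreover have "|g ` I| \<le>o r"
    using card_of_image I(2) by (rule ordLeq_transitive)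
  ultimately show "\<exists>I\<subseteq>A. |I| \<le>o r \<and> x \<in> closure I"
    using I(1) by (intro exI[of _ "g ` I"]) auto
qed

lemma frechet_transfer:
  assumes "frechet_space TYPE('y)"
  shows "frechet_space TYPE('z)"
  unfolding frechet_space_def
proof (intro allI impI)
  fix A :: "'z set" and x assume "x \<in> closure A"
  then obtain z where z: "z \<in> closure (S \<inter> g -` A)" "g z = x" "z \<in> S" by (rule closure_lift)
  obtain s where s: "\<And>n. s n \<in> S \<inter> g -` A" "s \<longlonglongrightarrow> z"
    using frechet_finite_fibres[OF assms S f fin _ z(1)] by blast
  then show "\<exists>s. (\<forall>n. s n \<in> A) \<and> s \<longlonglongrightarrow> x"
    using tendsto_image[of s z] z(2,3) by (intro exI[of _ "\<lambda>n. g (s n)"]) auto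
qed

lemma sequential_transfer:
  assumes "sequential_space TYPE('y)"
  shows "sequential_space TYPE('z)"
  unfolding sequential_space_def
proof (intro allI impI)
  fix A :: "'z set" assume A: "\<not> closed A"
  have "\<not> closed (S \<inter> g -` A)"
  proof
    assume "closed (S \<inter> g -` A)"
    then have "closed (g ` (S \<inter> (S \<inter> g -` A)))" by (rule closed_image_compact[OF S g])
    then show False using A by (simp add: image_preimage flip: Int_assoc)
  qed
  then obtain s z where s: "\<And>n. s n \<in> S \<inter> g -` A" "s \<longlonglongrightarrow> z" "z \<notin> S \<inter> g -` A"
    using sequential_finite_fibres[OF compact_target assms S f fin, of "S \<inter> g -` A"] by blast
  have "z \<in> S"
    using closed_sequentially[OF compact_imp_closed[OF S] _ s(2)] s(1) by auto
  then show "\<exists>s x. (\<forall>n. s n \<in> A) \<and> x \<notin> A \<and> s \<longlonglongrightarrow> x"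
    using tendsto_image[of s z] s by (intro exI[of _ "\<lambda>n. g (s n)"] exI[of _ "g z"]) auto
qed

lemma seq_compact_transfer:
  assumes "seq_compact (UNIV :: 'y set)"
  shows "seq_compact (UNIV :: 'z set)"
  unfolding seq_compact_def
proof (intro allI impI)
  fix a :: "nat \<Rightarrow> 'z"
  have "\<forall>n. a n \<in> g ` S" using surj by simp
  then have "\<forall>n. \<exists>z. z \<in> S \<and> a n = g z" by blast
  then obtain s where s: "\<And>n. s n \<in> S" "\<And>n. a n = g (s n)" by metis
  obtain z q where z: "z \<in> S" "strict_mono q" "(s \<circ> q) \<longlonglongrightarrow> z"
    using seq_compactE[OF seq_compact_finite_fibres[OF assms S f fin], of s] s(1) by blast
  then have "(a \<circ> q) \<longlonglongrightarrow> g z"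
    using tendsto_image[of "s \<circ> q" z] s by (simp add: o_def)
  then show "\<exists>l\<in>UNIV. \<exists>r. strict_mono r \<and> (a \<circ> r) \<longlonglongrightarrow> l" using z(2) by blast
qed

end

section \<open>Point masses of a positive embedding\<close>

lemma apply_Bcontfun_compact:
  fixes f :: "'k::topological_space \<Rightarrow> real"
  assumes "compact (UNIV :: 'k set)" "continuous_on UNIV f"
  shows "apply_bcontfun (Bcontfun f) = f"
proof (rule Bcontfun_inverse)
  have "bounded (range f)"
    using compact_continuous_image[OF assms(2,1)] by (rule compact_imp_bounded)
  then show "f \<in> bcontfun" using assms(2) by (simp add: bcontfun_def)
qed

lemma Urysohn_point_finite:
  fixes x :: "'k::t2_space"
  assumes K: "compact (UNIV :: 'k set)" and "finite F" "x \<notin> F"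
  obtains h :: "'k \<Rightarrow> real"
  where "continuous_on UNIV h" "\<And>z. 0 \<le> h z" "\<And>z. h z \<le> 1" "h x = 1" "\<And>z. z \<in> F \<Longrightarrow> h z = 0"
proof -
  have "Hausdorff_space (euclidean :: 'k topology)"
    unfolding Hausdorff_space_def disjnt_def by simp (metis hausdorff)
  then have "normal_space (euclidean :: 'k topology)"
    using K by (intro compact_Hausdorff_or_regular_imp_normal_space) (auto simp: compact_space_def)
  then obtain h where "continuous_map (euclidean :: 'k topology) (top_of_set {0..1::real}) h"
      "h ` F \<subseteq> {0}" "h ` {x} \<subseteq> {1}"
    using Urysohn_lemma[of "euclidean :: 'k topology" F "{x}" 0 1] assms(2,3)
    by (auto simp: finite_imp_closed)
  then show thesis
    by (intro that[of h]) (auto simp: continuous_map_in_subtopology Pi_iff)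
qed

locale positive_embedding =
  fixes T :: "('k::t2_space \<Rightarrow>\<^sub>C real) \<Rightarrow> ('l::t2_space \<Rightarrow>\<^sub>C real)" and m :: real
  assumes compact_K: "compact (UNIV :: 'k set)"
    and compact_L: "compact (UNIV :: 'l set)"
    and linear_T: "linear T"
    and positive_T: "positive_operator T"
    and m_pos: "0 < m"
    and lower_bound: "\<And>g. m * norm g \<le> norm (T g)"
begin

lemma T_nonneg: "(\<And>x. 0 \<le> apply_bcontfun g x) \<Longrightarrow> 0 \<le> apply_bcontfun (T g) y"
  using positive_T unfolding positive_operator_def by blast

lemma T_mono:
  assumes "\<And>x. apply_bcontfun g x \<le> apply_bcontfun h x"
  shows "apply_bcontfun (T g) y \<le> apply_bcontfun (T h) y"
  using T_nonneg[of "h - g" y] assms by (simp add: linear_diff[OF linear_T])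

text \<open>
  The pairs \<open>(y, x)\<close> for which the measure representing \<open>g \<mapsto> T g y\<close> gives \<open>x\<close> mass at least \<open>m\<close>.
  Testing against functions instead of computing the mass makes the closedness of the relation
  evident, as each inequality is continuous in \<open>(y, x)\<close>.
\<close>

definition heavy :: "('l \<times> 'k) set" where
  "heavy = {(y, x). \<forall>g. (\<forall>z. 0 \<le> apply_bcontfun g z) \<longrightarrow>
     m * apply_bcontfun g x \<le> apply_bcontfun (T g) y}"

lemma heavyD:
  assumes "(y, x) \<in> heavy" "\<And>z. 0 \<le> apply_bcontfun g z"
  shows "m * apply_bcontfun g x \<le> apply_bcontfun (T g) y"
  using assms unfolding heavy_def by blast

lemma compact_heavy: "compact heavy"
proof -
  have "heavy = (\<Inter>g\<in>{g. \<forall>z. 0 \<le> apply_bcontfun g z}.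
      {p. m * apply_bcontfun g (snd p) \<le> apply_bcontfun (T g) (fst p)})"
    unfolding heavy_def by auto
  moreover have "closed {p. m * apply_bcontfun g (snd p) \<le> apply_bcontfun (T g) (fst p)}" for g
    by (intro closed_Collect_le continuous_intros
        continuous_on_compose2[OF continuous_on_apply_bcontfun[of UNIV]]) auto
  ultimately have "closed heavy" by auto
  moreover have "compact (UNIV :: ('l \<times> 'k) set)"
    using compact_Times[OF compact_L compact_K] by simp
  ultimately show ?thesis using compact_Int_closed by fastforce
qed

lemma norm_attained_positive:
  assumes "\<And>x. 0 \<le> apply_bcontfun h x" "apply_bcontfun h x = 1"
  obtains y where "m \<le> apply_bcontfun (T h) y"
proof -
  obtain y where y: "\<And>z. apply_bcontfun (T h) z \<le> apply_bcontfun (T h) y"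
    using continuous_attains_sup[OF compact_L _ continuous_on_apply_bcontfun] by auto
  have "m * 1 \<le> m * norm h"
    using norm_bounded[of h x] assms(2) m_pos by (intro mult_left_mono) auto
  also have "\<dots> \<le> norm (T h)" by (rule lower_bound)
  also have "\<dots> \<le> apply_bcontfun (T h) y"
    using y T_nonneg[OF assms(1)] by (intro norm_bound) auto
  finally show thesis using that by simp
qed

text \<open>
  Positivity makes the sets \<open>{y. m \<le> T h y}\<close> shrink as \<open>h\<close> decreases, and the minimum of finitely
  many functions that are \<open>1\<close> at \<open>x\<close> is still \<open>1\<close> at \<open>x\<close>. This gives the finite intersection
  property; a common point \<open>y\<close> sees mass \<open>m\<close> however closely \<open>h\<close> concentrates around \<open>x\<close>.
\<close>

lemma ex_large_point_mass: "\<exists>y. (y, x) \<in> heavy"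
proof -
  let ?H = "{h :: 'k \<Rightarrow>\<^sub>C real. (\<forall>z. 0 \<le> apply_bcontfun h z \<and> apply_bcontfun h z \<le> 1) \<and> apply_bcontfun h x = 1}"
  let ?P = "\<lambda>h. {y. m \<le> apply_bcontfun (T h) y}"
  have lower: "\<exists>h\<in>?H. \<forall>h'\<in>G. \<forall>z. apply_bcontfun h z \<le> apply_bcontfun h' z"
    if "finite G" "G \<subseteq> ?H" for G
    using that
  proof (induction G)
    case empty
    show ?case by (intro bexI[of _ "const_bcontfun 1"]) (auto simp: const_bcontfun.rep_eq)
  next
    case (insert h' G)
    then obtain h where h: "h \<in> ?H" "\<forall>h'\<in>G. \<forall>z. apply_bcontfun h z \<le> apply_bcontfun h' z"
      by auto
    let ?k = "Bcontfun (\<lambda>z. min (apply_bcontfun h z) (apply_bcontfun h' z))"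
    have k: "apply_bcontfun ?k = (\<lambda>z. min (apply_bcontfun h z) (apply_bcontfun h' z))"
      by (intro apply_Bcontfun_compact compact_K continuous_intros) auto
    show ?case
      using h insert.prems by (intro bexI[of _ ?k]) (auto simp: k min.coboundedI1)
  qed
  have "UNIV \<inter> \<Inter> (?P ` ?H) \<noteq> {}"
  proof (rule compact_imp_fip[OF compact_L])
    show "closed P" if "P \<in> ?P ` ?H" for P
      using that by (auto intro!: closed_Collect_le continuous_intros)
    show "UNIV \<inter> \<Inter> \<P> \<noteq> {}" if \<P>: "finite \<P>" "\<P> \<subseteq> ?P ` ?H" for \<P>
    proof -
      obtain G where G: "G \<subseteq> ?H" "finite G" "\<P> = ?P ` G"
        using finite_subset_image[OF \<P>] by blast
      obtain h where h: "h \<in> ?H" "\<forall>h'\<in>G. \<forall>z. apply_bcontfun h z \<le> apply_bcontfun h' z"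
        using lower[OF G(2,1)] by blast
      then obtain y where "m \<le> apply_bcontfun (T h) y"
        using norm_attained_positive[of h x] by auto
      moreover have "apply_bcontfun (T h) y \<le> apply_bcontfun (T h') y" if "h' \<in> G" for h'
        using h(2) that by (intro T_mono) auto
      ultimately have "y \<in> \<Inter> \<P>" unfolding G(3) by force
      then show ?thesis by blast
    qed
  qed
  then obtain y where y: "\<And>h. h \<in> ?H \<Longrightarrow> m \<le> apply_bcontfun (T h) y" by blast
  have "m * apply_bcontfun g x \<le> apply_bcontfun (T g) y" if g: "\<And>z. 0 \<le> apply_bcontfun g z" for g
  proof (cases "apply_bcontfun g x = 0")
    case True
    then show ?thesis using T_nonneg[OF g] by simp
  next
    case False
    define c where "c = apply_bcontfun g x"
    have c: "0 < c" using False g[of x] by (simp add: c_def)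
    \<comment> \<open>Truncating \<open>g / g x\<close> at \<open>1\<close> brings it into the directed family.\<close>
    let ?h = "Bcontfun (\<lambda>z. min 1 (apply_bcontfun g z / c))"
    have h: "apply_bcontfun ?h = (\<lambda>z. min 1 (apply_bcontfun g z / c))"
      using c by (intro apply_Bcontfun_compact compact_K continuous_intros) auto
    have "m \<le> apply_bcontfun (T ?h) y"
      using c g by (intro y) (auto simp: h simp flip: c_def)
    also have "\<dots> \<le> apply_bcontfun (T (inverse c *\<^sub>R g)) y"
      by (intro T_mono) (simp add: h field_simps)
    also have "\<dots> = apply_bcontfun (T g) y / c"
      by (simp add: linear_scale[OF linear_T] field_simps)
    finally show ?thesis using c by (simp add: c_def field_simps)
  qed
  then show ?thesis unfolding heavy_def by blast
qed

text \<open>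
  The induction splits \<open>g\<close> as \<open>h g + (1 - h) g\<close>, where \<open>h\<close> is \<open>1\<close> at the new point and \<open>0\<close> at the
  earlier ones: the first summand accounts for the mass at the new point, and the second one has
  the same values as \<open>g\<close> at the earlier points.
\<close>

lemma sum_point_masses_le:
  assumes "finite F" "\<And>x. x \<in> F \<Longrightarrow> (y, x) \<in> heavy" "\<And>z. 0 \<le> apply_bcontfun g z"
  shows "m * (\<Sum>x\<in>F. apply_bcontfun g x) \<le> apply_bcontfun (T g) y"
  using assms
proof (induction F arbitrary: g)
  case empty
  then show ?case using T_nonneg by simp
next
  case (insert x F)
  obtain h :: "'k \<Rightarrow> real" where h: "continuous_on UNIV h" "\<And>z. 0 \<le> h z" "\<And>z. h z \<le> 1"
      "h x = 1" "\<And>z. z \<in> F \<Longrightarrow> h z = 0"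
    by (rule Urysohn_point_finite[OF compact_K insert.hyps]) blast
  let ?g1 = "Bcontfun (\<lambda>z. h z * apply_bcontfun g z)"
  let ?g2 = "g - ?g1"
  have g1: "apply_bcontfun ?g1 = (\<lambda>z. h z * apply_bcontfun g z)"
    by (intro apply_Bcontfun_compact compact_K continuous_intros h) auto
  have g2_eq: "apply_bcontfun ?g2 z = (1 - h z) * apply_bcontfun g z" for z
    by (simp add: g1 algebra_simps)
  have "m * apply_bcontfun ?g1 x \<le> apply_bcontfun (T ?g1) y"
    by (rule heavyD) (use insert.prems h(2) in \<open>auto simp: g1\<close>)
  moreover have "m * (\<Sum>z\<in>F. apply_bcontfun ?g2 z) \<le> apply_bcontfun (T ?g2) y"
  proof (rule insert.IH)
    show "0 \<le> apply_bcontfun ?g2 z" for z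
      unfolding g2_eq using insert.prems(2) h(3) by simp
  qed (use insert.prems in auto)
  moreover have "(\<Sum>z\<in>F. apply_bcontfun ?g2 z) = (\<Sum>z\<in>F. apply_bcontfun g z)"
    by (intro sum.cong refl) (simp add: g2_eq h(5) del: minus_bcontfun.rep_eq)
  ultimately show ?case
    using insert.hyps by (simp add: linear_diff[OF linear_T] g1 h(4) algebra_simps)
qed

lemma finite_large_point_masses: "finite {x. (y, x) \<in> heavy}"
proof (rule ccontr)
  assume inf: "infinite {x. (y, x) \<in> heavy}"
  obtain n :: nat where n: "apply_bcontfun (T (const_bcontfun 1)) y < real n * m"
    using reals_Archimedean3[OF m_pos] by blast
  obtain F where F: "F \<subseteq> {x. (y, x) \<in> heavy}" "finite F" "card F = n"
    using infinite_arbitrarily_large[OF inf] by blast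
  have "m * (\<Sum>x\<in>F. apply_bcontfun (const_bcontfun 1) x)
      \<le> apply_bcontfun (T (const_bcontfun 1)) y"
    using F by (intro sum_point_masses_le) (auto simp: const_bcontfun.rep_eq)
  then show False using n F(3) by (simp add: const_bcontfun.rep_eq mult.commute)
qed

end

theorem theorem4p3:
  fixes T :: "('k::t2_space \<Rightarrow>\<^sub>C real) \<Rightarrow> ('l::t2_space \<Rightarrow>\<^sub>C real)"
  assumes "compact (UNIV :: 'k set)"
    and "compact (UNIV :: 'l set)"
    and "isomorphic_embedding T"
    and "positive_operator T"
  shows "tightness TYPE('k) \<le>o tightness TYPE('l)
    \<and> (frechet_space TYPE('l) \<longrightarrow> frechet_space TYPE('k))
    \<and> (sequential_space TYPE('l) \<longrightarrow> sequential_space TYPE('k))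
    \<and> (seq_compact (UNIV :: 'l set) \<longrightarrow> seq_compact (UNIV :: 'k set))"
proof -
  obtain m where m: "m > 0" "\<And>g. m * norm g \<le> norm (T g)"
    using assms(3) unfolding isomorphic_embedding_def by blast
  have lin: "linear T" using assms(3) by (simp add: isomorphic_embedding_def)
  interpret positive_embedding T m
    by (rule positive_embedding.intro) (fact assms lin m)+
  interpret finite_fibre_correspondence heavy fst snd
  proof
    show "finite {p \<in> heavy. fst p = y}" for y
    proof (rule finite_subset)
      show "{p \<in> heavy. fst p = y} \<subseteq> Pair y ` {x. (y, x) \<in> heavy}" by auto
    qed (intro finite_imageI finite_large_point_masses)
    show "snd ` heavy = UNIV" using ex_large_point_mass by force
  qed (auto intro: compact_L compact_heavy continuous_intros)
  have "tightness TYPE('k) \<le>o tightness TYPE('l)"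
    by (intro tightness_least Card_order_tightness tightness_bound_transfer
        tightness_bound_tightness)
  then show ?thesis
    using frechet_transfer sequential_transfer seq_compact_transfer by blast
qed

end
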